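(* Every chordal graph with at least one edge has an effective competition cover.
   Context: All graphs are finite and simple; digraphs are finite, without loops or multiple arcs. The competition graph $C(D)$ of a digraph $D$ has vertex set $V(D)$, and two distinct vertices $x,y$ are adjacent in it if and only if there is a vertex $z$ with arcs $(x,z)$ and $(y,z)$ in $D$. The competition number $k(G)$ of a graph $G$ is the smallest $k\ge 0$ such that $G$ together with $k$ new isolated vertices is the competition graph of an acyclic digraph. A clique (a vertex set inducing a complete subgraph) covers an edge if it contains both of its ends. An edge clique cover is a family of cliques covering all edges; $\theta_e(G)$ is the minimum size of one; a minimum edge clique cover is one of size $\theta_e(G)$. For a graph $G$ with at least one edge, a minimum edge clique cover $\mathcal{C}=\{C_1,\dots,C_{\theta_e(G)}\}$ is an effective competition cover of $G$ if every $C_i$ is a maximal clique of $G$ and there is an acyclic digraph $D$ whose competition graph is $G$ together with $k(G)$ isolated vertices, such that the set of vertices of nonzero in-degree of $D$ is $\{w_1,\dots,w_{\theta_e(G)}\}$ where, for each $i$, $w_i$ is a common out-neighbor of all vertices of $C_i$. *)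

theory Defs
  imports "Graph_Theory.Pair_Digraph"
begin

text \<open>
  A finite simple graph is a \<^const>\<open>pair_graph\<close>: every edge is represented by both of its
  orientations. A finite digraph without loops or multiple arcs is a \<^const>\<open>pair_digraph\<close>.
\<close>

text \<open>The length of a closed walk is its number of arcs, and \<open>fst ` set p\<close> is its set of vertices.\<close>

definition chordal :: "'a pair_pre_digraph \<Rightarrow> bool" where
  "chordal G \<longleftrightarrow>
    (\<forall>p. pre_digraph.cycle (with_proj G) p \<and> 4 \<le> length p \<longrightarrow>
      (\<exists>x \<in> fst ` set p. \<exists>y \<in> fst ` set p.
        (x, y) \<in> parcs G \<and> (x, y) \<notin> set p \<and> (y, x) \<notin> set p))"

definition competition_graph :: "'a pair_pre_digraph \<Rightarrow> 'a pair_pre_digraph" where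
  "competition_graph D = \<lparr> pverts = pverts D,
     parcs = {(x, y). x \<in> pverts D \<and> y \<in> pverts D \<and> x \<noteq> y \<and>
       (\<exists>z \<in> pverts D. (x, z) \<in> parcs D \<and> (y, z) \<in> parcs D)} \<rparr>"

text \<open>The sum type provides the new vertices, whatever the vertex type of the graph is.\<close>

definition add_isolated :: "'a pair_pre_digraph \<Rightarrow> nat \<Rightarrow> ('a + nat) pair_pre_digraph" where
  "add_isolated G k = \<lparr> pverts = Inl ` pverts G \<union> Inr ` {..<k},
     parcs = {(Inl x, Inl y) | x y. (x, y) \<in> parcs G} \<rparr>"

definition competition_number :: "'a pair_pre_digraph \<Rightarrow> nat" where
  "competition_number G =
    (LEAST k. \<exists>D. pair_digraph D \<and> acyclic (parcs D) \<and> competition_graph D = add_isolated G k)"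

definition clique :: "'a pair_pre_digraph \<Rightarrow> 'a set \<Rightarrow> bool" where
  "clique G K \<longleftrightarrow> K \<subseteq> pverts G \<and> (\<forall>x \<in> K. \<forall>y \<in> K. x \<noteq> y \<longrightarrow> (x, y) \<in> parcs G)"

definition maximal_clique :: "'a pair_pre_digraph \<Rightarrow> 'a set \<Rightarrow> bool" where
  "maximal_clique G K \<longleftrightarrow> clique G K \<and> (\<forall>K'. clique G K' \<and> K \<subseteq> K' \<longrightarrow> K' = K)"

definition edge_clique_cover :: "'a pair_pre_digraph \<Rightarrow> 'a set set \<Rightarrow> bool" where
  "edge_clique_cover G \<C> \<longleftrightarrow> finite \<C> \<and> (\<forall>K \<in> \<C>. clique G K) \<and>
    (\<forall>x y. (x, y) \<in> parcs G \<longrightarrow> (\<exists>K \<in> \<C>. x \<in> K \<and> y \<in> K))"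

definition edge_clique_cover_number :: "'a pair_pre_digraph \<Rightarrow> nat" where
  "edge_clique_cover_number G = (LEAST n. \<exists>\<C>. edge_clique_cover G \<C> \<and> card \<C> = n)"

definition minimum_edge_clique_cover :: "'a pair_pre_digraph \<Rightarrow> 'a set set \<Rightarrow> bool" where
  "minimum_edge_clique_cover G \<C> \<longleftrightarrow>
    edge_clique_cover G \<C> \<and> card \<C> = edge_clique_cover_number G"

text \<open>
  The vertex \<open>w K\<close> is the one attached to the clique \<open>K\<close>. Injectivity of \<open>w\<close> is no extra demand:
  the in-neighbourhoods in \<open>D\<close> that lie in \<open>G\<close> form an edge clique cover of \<open>G\<close>, so at least
  \<open>card \<C>\<close> vertices have nonzero in-degree.
\<close>

definition effective_competition_cover :: "'a pair_pre_digraph \<Rightarrow> 'a set set \<Rightarrow> bool" where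
  "effective_competition_cover G \<C> \<longleftrightarrow>
    minimum_edge_clique_cover G \<C> \<and> (\<forall>K \<in> \<C>. maximal_clique G K) \<and>
    (\<exists>D w. pair_digraph D \<and> acyclic (parcs D) \<and>
      competition_graph D = add_isolated G (competition_number G) \<and>
      bij_betw w \<C> {v \<in> pverts D. in_degree (with_proj D) v \<noteq> 0} \<and>
      (\<forall>K \<in> \<C>. \<forall>x \<in> K. (Inl x, w K) \<in> parcs D))"

end

theory Submission
  imports Defs
begin

text \<open>
  A chordal graph has a perfect elimination ordering (Dirac), and in it every maximal clique is
  determined by its first vertex. Hence every minimum edge clique cover by maximal cliques is
  effective: order its cliques by their first vertices, direct each clique to the first vertex of
  the preceding clique, which lies in no later clique, and direct the first clique to an isolated
  vertex. Such a vertex is necessary, since an acyclic digraph has a sink, so the competition number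
  is \<open>0\<close> if the graph has an isolated vertex and \<open>1\<close> otherwise.
\<close>

text \<open>Stated relative to a vertex set \<open>T\<close>, so that inductions shrink
  \<open>T\<close> inside one fixed graph instead of passing to induced subgraphs.\<close>

definition simplicial :: "'a rel \<Rightarrow> 'a set \<Rightarrow> 'a \<Rightarrow> bool" where
  "simplicial E T s \<longleftrightarrow>
    (\<forall>x \<in> T. \<forall>y \<in> T. (s, x) \<in> E \<longrightarrow> (s, y) \<in> E \<longrightarrow> x \<noteq> y \<longrightarrow> (x, y) \<in> E)"

section \<open>Shortest paths, closed walks and predecessors\<close>

lemma rtrancl_successively:
  assumes "(x, y) \<in> R\<^sup>*"
  shows "\<exists>p. p \<noteq> [] \<and> hd p = x \<and> last p = y \<and> successively (\<lambda>a b. (a, b) \<in> R) p"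
  using assms
proof (induction rule: converse_rtrancl_induct)
  case base
  show ?case by (rule exI[of _ "[y]"]) simp
next
  case (step a b)
  then obtain p where "p \<noteq> []" "hd p = b" "last p = y" "successively (\<lambda>a b. (a, b) \<in> R) p"
    by blast
  with step.hyps show ?case
    by (intro exI[of _ "a # p"]) (auto simp: successively_Cons)
qed

text \<open>A shortest path works, since an arc that skips vertices would shorten it. The claim
  concerns forward arcs; for symmetric \<open>R\<close> the path is induced.\<close>

lemma induced_path_exists:
  assumes "(x, y) \<in> R\<^sup>*"
  obtains p where "p \<noteq> []" "hd p = x" "last p = y" "successively (\<lambda>a b. (a, b) \<in> R) p"
    "distinct p" "\<And>i j. i < j \<Longrightarrow> j < length p \<Longrightarrow> (p ! i, p ! j) \<in> R \<Longrightarrow> j = Suc i"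
proof -
  define W where "W p \<longleftrightarrow> p \<noteq> [] \<and> hd p = x \<and> last p = y \<and> successively (\<lambda>a b. (a, b) \<in> R) p" for p
  obtain q where "W q" using rtrancl_successively[OF assms] unfolding W_def by blast
  then obtain p where p: "W p" and least: "\<And>q. W q \<Longrightarrow> length p \<le> length q"
    using ex_has_least_nat[of W q length] by blast
  have shortcut: False
    if "i < j" "j < length p" "(p ! i, p ! j) \<in> R" "j \<noteq> Suc i" for i j
  proof -
    let ?q = "take (Suc i) p @ drop j p"
    have "successively (\<lambda>a b. (a, b) \<in> R) (take (Suc i) p @ drop (Suc i) p)"
      and "successively (\<lambda>a b. (a, b) \<in> R) (take j p @ drop j p)"
      using p by (auto simp: W_def)
    then have "successively (\<lambda>a b. (a, b) \<in> R) (take (Suc i) p)"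
      "successively (\<lambda>a b. (a, b) \<in> R) (drop j p)"
      unfolding successively_append_iff by blast+
    moreover have "last (take (Suc i) p) = p ! i" "hd (drop j p) = p ! j"
      using that by (auto simp: take_Suc_conv_app_nth hd_drop_conv_nth)
    ultimately have "W ?q"
      using that p by (auto simp: W_def successively_append_iff hd_append)
    from least[OF this] that show False by auto
  qed
  have "distinct p"
  proof (rule ccontr)
    assume "\<not> distinct p"
    then obtain i j where ij: "i < j" "j < length p" "p ! i = p ! j"
      by (metis distinct_conv_nth linorder_neqE_nat)
    show False
    proof (cases i)
      case 0
      \<comment> \<open>The repeated vertex is the start, which has no predecessor to jump from, so
        the path is begun at the later occurrence.\<close>
      then have "W (drop j p)"
        using p ij
        by (auto simp: W_def hd_drop_conv_nth hd_conv_nth)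
          (metis append_take_drop_id successively_append_iff)
      from least[OF this] ij show False by auto
    next
      case (Suc k)
      \<comment> \<open>Since \<open>p ! i = p ! j\<close>, the arc into the first occurrence is
        also an arc from \<open>p ! k\<close> to \<open>p ! j\<close>, a shortcut.\<close>
      have "(p ! k, p ! Suc k) \<in> R"
        using p ij(1,2) Suc by (simp add: W_def successively_conv_nth)
      with shortcut[of k j] ij Suc show False by auto
    qed
  qed
  with p shortcut show thesis
    by (intro that[of p]) (auto simp: W_def)
qed

text \<open>The zip lists the consecutive pairs of \<open>x # xs @ [y]\<close>; for
  \<open>y = x\<close> these are the arcs of a closed walk.\<close>

lemma pcas_zip: "pcas x (zip (x # xs) (xs @ [y])) y"
  by (induction xs arbitrary: x) auto

lemma pawalk_verts_zip: "pawalk_verts x (zip (x # xs) (xs @ [y])) = x # xs @ [y]"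
  by (induction xs arbitrary: x) auto

text \<open>With \<open>g\<close> the rank of the first vertex of a clique, \<open>p\<close> yields
  the preceding clique, and \<open>None\<close> marks the first one.\<close>

lemma ex_predecessor_map:
  fixes g :: "'b \<Rightarrow> nat"
  assumes "finite C"
  obtains p where "\<And>K. K \<in> C \<Longrightarrow>
    p K = None \<and> (\<forall>L \<in> C. g K \<le> g L) \<or>
    (\<exists>L \<in> C. p K = Some L \<and> g L < g K \<and> (\<forall>M \<in> C. g M < g K \<longrightarrow> g M \<le> g L))"
proof -
  have "\<exists>q. q = None \<and> (\<forall>L \<in> C. g K \<le> g L) \<or>
    (\<exists>L \<in> C. q = Some L \<and> g L < g K \<and> (\<forall>M \<in> C. g M < g K \<longrightarrow> g M \<le> g L))" for K
  proof (cases "\<forall>L \<in> C. g K \<le> g L")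
    case False
    let ?B = "{L \<in> C. g L < g K}"
    have "finite (g ` ?B)" "g ` ?B \<noteq> {}" using assms False by (auto simp: not_le)
    note max = Max_in[OF this] Max_ge[OF this(1)]
    from max(1) obtain L where "L \<in> ?B" "g L = Max (g ` ?B)" by auto
    with max(2) show ?thesis by (intro exI[of _ "Some L"]) auto
  qed auto
  then show thesis using that by metis
qed

section \<open>Maximal cliques, minimum covers and sinks\<close>

lemma maximal_clique_extends:
  assumes "finite (pverts G)" "clique G K"
  obtains M where "maximal_clique G M" "K \<subseteq> M"
proof -
  let ?S = "{M. clique G M \<and> K \<subseteq> M}"
  have "finite ?S"
    by (rule finite_subset[of _ "Pow (pverts G)"]) (use assms in \<open>auto simp: clique_def\<close>)
  moreover have "?S \<noteq> {}" using assms(2) by blast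
  ultimately have "\<exists>M \<in> ?S. \<forall>N \<in> ?S. M \<subseteq> N \<longrightarrow> M = N"
    by (rule finite_has_maximal)
  then obtain M where M: "M \<in> ?S" and max: "\<forall>N \<in> ?S. M \<subseteq> N \<longrightarrow> M = N"
    by (rule bexE)
  have "N = M" if "clique G N" "M \<subseteq> N" for N
    using max[rule_format, of N] that M by auto
  with M show thesis by (intro that[of M]) (simp_all add: maximal_clique_def)
qed

lemma clique_cover_number_le: "edge_clique_cover G \<C> \<Longrightarrow> edge_clique_cover_number G \<le> card \<C>"
  unfolding edge_clique_cover_number_def by (rule Least_le) blast

text \<open>A clique covering no edge could be dropped from the cover. Hence no clique of a minimum
  cover contains an isolated vertex.\<close>

lemma minimum_cover_has_edge:
  assumes "minimum_edge_clique_cover G \<C>" "K \<in> \<C>"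
  shows "\<exists>x \<in> K. \<exists>y \<in> K. (x, y) \<in> parcs G"
proof (rule ccontr)
  assume "\<not> ?thesis"
  with assms have "edge_clique_cover G (\<C> - {K})"
    by (fastforce simp: minimum_edge_clique_cover_def edge_clique_cover_def)
  from clique_cover_number_le[OF this] have "card \<C> \<le> card (\<C> - {K})"
    using assms(1) by (simp add: minimum_edge_clique_cover_def)
  moreover have "card (\<C> - {K}) < card \<C>"
    using assms
    by (intro card_Diff1_less) (auto simp: minimum_edge_clique_cover_def edge_clique_cover_def)
  ultimately show False by simp
qed

text \<open>A finite acyclic digraph has a sink, and a sink shares no out-neighbour with any
  vertex.\<close>

lemma acyclic_competition_graph_has_isolated:
  assumes "pair_digraph D" "acyclic (parcs D)" "pverts D \<noteq> {}"
  shows "\<exists>v \<in> pverts D. \<forall>u. (v, u) \<notin> parcs (competition_graph D)"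
proof -
  interpret D: pair_digraph D by (rule assms(1))
  have "wf ((parcs D)\<inverse>)" using D.pair_finite_arcs assms(2) by (rule finite_acyclic_wf_converse)
  then obtain v where "v \<in> pverts D" "\<And>u. (v, u) \<in> parcs D \<Longrightarrow> u \<notin> pverts D"
    using assms(3) by (metis converse_iff wfE_min')
  then show ?thesis by (auto simp: competition_graph_def)
qed

section \<open>Chordal graphs and perfect elimination orderings\<close>

context pair_graph
begin

lemma arcs_sym: "(x, y) \<in> parcs G \<Longrightarrow> (y, x) \<in> parcs G"
  using pair_sym_arcs by (auto simp: symmetric_def sym_def)

lemma arcs_irrefl: "(x, x) \<notin> parcs G"
  using pair_no_loops by force

text \<open>Closing the induced path \<open>p\<close> through \<open>v\<close> gives a cycle with
  \<open>length p + 1\<close> arcs, hence at least 4, and without a chord.\<close>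

lemma chordal_no_hole:
  assumes "chordal G" and "p \<noteq> []" "distinct p" "v \<notin> set p" "3 \<le> length p"
    and path: "\<And>i. Suc i < length p \<Longrightarrow> (p ! i, p ! Suc i) \<in> parcs G"
    and induced: "\<And>i j. i < j \<Longrightarrow> j < length p \<Longrightarrow> (p ! i, p ! j) \<in> parcs G \<Longrightarrow> j = Suc i"
    and ends: "\<And>u. u \<in> set p \<Longrightarrow> (v, u) \<in> parcs G \<longleftrightarrow> u = hd p \<or> u = last p"
  shows False
proof -
  let ?c = "zip (v # p) (p @ [v])"
  have nth: "?c ! 0 = (v, hd p)" "?c ! length p = (last p, v)"
    "\<And>i. Suc i < length p \<Longrightarrow> ?c ! Suc i = (p ! i, p ! Suc i)"
    using assms(2) by (auto simp: nth_append hd_conv_nth last_conv_nth nth_Cons')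
  have mem: "?c ! i \<in> set ?c" if "i \<le> length p" for i
    by (rule nth_mem) (use that in simp)
  have set: "(v, hd p) \<in> set ?c" "(last p, v) \<in> set ?c"
    using mem[of 0] mem[of "length p"] by (simp_all only: nth(1,2) le0 order_refl)
  have set_inner: "(p ! i, p ! Suc i) \<in> set ?c" if "Suc i < length p" for i
    using mem[of "Suc i"] nth(3)[OF that] that by simp
  have arcs: "set ?c \<subseteq> parcs G"
  proof
    fix e assume "e \<in> set ?c"
    then obtain i where i: "i < length ?c" "e = ?c ! i" by (metis in_set_conv_nth)
    then consider "i = 0" | "i = length p" | k where "i = Suc k" "Suc k < length p"
      by (cases i) fastforce+
    then show "e \<in> parcs G"
    proof cases
      case 1
      with i nth ends[of "hd p"] assms(2) show ?thesis by simp
    next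
      case 2
      with i nth ends[of "last p"] assms(2) arcs_sym show ?thesis by simp
    next
      case 3
      with i nth path show ?thesis by metis
    qed
  qed
  have "v \<in> pverts G" using arcs set(1) in_arcsD1 by blast
  with arcs have "cycle ?c"
    unfolding cycle_def awalk_def
    using assms(3,4) pcas_zip[of v p v] pawalk_verts_zip[of v p v]
    by (intro exI[of _ v]) auto
  moreover have "fst ` set ?c = set (v # p)"
    by (metis length_Cons length_append_singleton list.set_map map_fst_zip)
  moreover have "4 \<le> length ?c" using assms(5) by simp
  ultimately obtain x y where xy: "x \<in> set (v # p)" "y \<in> set (v # p)" "(x, y) \<in> parcs G"
    "(x, y) \<notin> set ?c" "(y, x) \<notin> set ?c"
    using assms(1) unfolding chordal_def by metis
  \<comment> \<open>A chord would either meet \<open>v\<close> (\<open>apex\<close>) or join two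
    vertices of \<open>p\<close> (\<open>inner\<close>); in both cases the edge already lies on the
    cycle.\<close>
  have apex: "(v, u) \<in> set ?c \<or> (u, v) \<in> set ?c" if "u \<in> set p" "(v, u) \<in> parcs G" for u
    using that ends set by metis
  have inner: "(p ! i, p ! j) \<in> set ?c"
    if "i < j" "j < length p" "(p ! i, p ! j) \<in> parcs G" for i j
    using induced[OF that] that set_inner by metis
  show False
  proof (cases "x = v \<or> y = v")
    case True
    then show False using xy apex arcs_sym arcs_irrefl by (metis set_ConsD)
  next
    case False
    then obtain i j where "i < length p" "j < length p" "x = p ! i" "y = p ! j"
      using xy(1,2) by (auto simp: in_set_conv_nth)
    then show False
      using xy(3-) inner[of i j] inner[of j i] arcs_sym arcs_irrefl by (metis linorder_neqE_nat)
  qed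
qed

text \<open>Dirac's theorem, strengthened so that the induction goes through: the simplicial vertex can
  be found outside the neighbourhood of \<open>v\<close>. The neighbourhood \<open>B\<close> of a component \<open>C\<close> of the
  non-neighbours of \<open>v\<close> is a clique, so a simplicial vertex of \<open>C \<union> B\<close> that avoids \<open>B\<close> remains
  simplicial in \<open>T\<close>.\<close>

lemma ex_simplicial_nonneighbour:
  assumes "chordal G" "finite T" "v \<in> T" "u \<in> T" "u \<noteq> v" "(v, u) \<notin> parcs G"
  shows "\<exists>s \<in> T. s \<noteq> v \<and> (v, s) \<notin> parcs G \<and> simplicial (parcs G) T s"
  using assms(2-)
proof (induction T arbitrary: u v rule: finite_psubset_induct)
  case (psubset T)
  define A where "A = {a \<in> T. a \<noteq> v \<and> (v, a) \<notin> parcs G}"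
  define C where "C = {c. (u, c) \<in> (parcs G \<inter> A \<times> A)\<^sup>*}"
  define B where "B = {b \<in> T. (v, b) \<in> parcs G \<and> (\<exists>c \<in> C. (b, c) \<in> parcs G)}"
  have uA: "u \<in> A" using psubset.prems by (simp add: A_def)
  have uC: "u \<in> C" by (simp add: C_def)
  have CA: "C \<subseteq> A"
  proof
    fix c assume "c \<in> C"
    then have "(u, c) \<in> (parcs G \<inter> A \<times> A)\<^sup>*" by (simp add: C_def)
    then show "c \<in> A" by (cases rule: rtranclE) (use uA in auto)
  qed
  \<comment> \<open>No edge within \<open>T\<close> leaves \<open>C\<close> except into
    \<open>B\<close>, so a vertex of \<open>C\<close> that is simplicial in
    \<open>C \<union> B\<close> is so in \<open>T\<close>.\<close>
  have nbr_C: "d \<in> C \<union> B" if "c \<in> C" "d \<in> T" "(c, d) \<in> parcs G" for c d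
  proof (cases "d \<in> A")
    case True
    with that CA have "(c, d) \<in> parcs G \<inter> A \<times> A" by auto
    with that(1) show ?thesis by (auto simp: C_def intro: rtrancl_into_rtrancl)
  next
    case False
    moreover have "d \<noteq> v" using that CA arcs_sym by (auto simp: A_def)
    ultimately have "(v, d) \<in> parcs G" using that by (auto simp: A_def)
    with that arcs_sym show ?thesis by (auto simp: B_def)
  qed
  have clique_B: "(x, y) \<in> parcs G" if xy: "x \<in> B" "y \<in> B" "x \<noteq> y" for x y
  proof (rule ccontr)
    assume non: "(x, y) \<notin> parcs G"
    \<comment> \<open>A shortest path from \<open>x\<close> to \<open>y\<close> with its interior in
      \<open>A\<close> closes up through \<open>v\<close> to a hole, because \<open>x\<close> and
      \<open>y\<close> are the only neighbours of \<open>v\<close> in \<open>S\<close>.\<close>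
    define S where "S = insert x (insert y A)"
    define R where "R = parcs G \<inter> S \<times> S"
    obtain c d where cd: "c \<in> C" "d \<in> C" "(x, c) \<in> parcs G" "(y, d) \<in> parcs G"
      using xy by (auto simp: B_def)
    have sub: "(parcs G \<inter> A \<times> A)\<^sup>* \<subseteq> R\<^sup>*" by (rule rtrancl_mono) (auto simp: R_def S_def)
    have symR: "sym R" using arcs_sym by (auto simp: R_def sym_def)
    have "(u, c) \<in> R\<^sup>*" "(u, d) \<in> R\<^sup>*" using cd(1,2) sub by (auto simp: C_def)
    then have "(c, d) \<in> R\<^sup>*" using sym_rtrancl[OF symR] by (meson rtrancl_trans symD)
    moreover have "(x, c) \<in> R" "(d, y) \<in> R"
      using cd CA arcs_sym by (auto simp: R_def S_def)
    ultimately have "(x, y) \<in> R\<^sup>*" by (meson converse_rtrancl_into_rtrancl rtrancl_into_rtrancl)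
    then obtain p where p: "p \<noteq> []" "hd p = x" "last p = y"
      "successively (\<lambda>a b. (a, b) \<in> R) p" "distinct p"
      "\<And>i j. i < j \<Longrightarrow> j < length p \<Longrightarrow> (p ! i, p ! j) \<in> R \<Longrightarrow> j = Suc i"
      using induced_path_exists by metis
    have path: "(p ! i, p ! Suc i) \<in> R" if "Suc i < length p" for i
      using p(4) that by (auto simp: successively_conv_nth)
    have setp: "set p \<subseteq> S"
    proof
      fix a assume "a \<in> set p"
      then obtain i where "i < length p" "a = p ! i" by (metis in_set_conv_nth)
      then show "a \<in> S"
        using path[of "i - 1"] p(1,2) by (cases i) (auto simp: R_def S_def hd_conv_nth)
    qed
    have len: "3 \<le> length p"
    proof (rule ccontr)
      assume "\<not> 3 \<le> length p"
      then consider a where "p = [a]" | a b where "p = [a, b]"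
        using p(1) by (cases p rule: remdups_adj.cases) (auto simp: not_le)
      then show False using p(2-4) non xy(3) by cases (auto simp: R_def)
    qed
    show False
    proof (rule chordal_no_hole[of p v])
      show "v \<notin> set p" using setp xy arcs_irrefl by (auto simp: S_def A_def B_def)
      show "(v, a) \<in> parcs G \<longleftrightarrow> a = hd p \<or> a = last p" if "a \<in> set p" for a
        using that setp xy p(2,3) by (auto simp: S_def A_def B_def)
      show "j = Suc i" if "i < j" "j < length p" "(p ! i, p ! j) \<in> parcs G" for i j
      proof (rule p(6)[OF that(1,2)])
        have "p ! i \<in> set p" "p ! j \<in> set p" using that by simp_all
        with setp that(3) show "(p ! i, p ! j) \<in> R" by (auto simp: R_def)
      qed
    qed (use assms(1) p(1,5) len path in \<open>auto simp: R_def\<close>)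
  qed
  have "\<exists>s \<in> C. simplicial (parcs G) (C \<union> B) s"
  proof (cases "\<exists>a \<in> C \<union> B. \<exists>b \<in> C \<union> B. a \<noteq> b \<and> (a, b) \<notin> parcs G")
    case False
    then show ?thesis using uC by (auto simp: simplicial_def)
  next
    case True
    \<comment> \<open>The non-adjacent pair is chosen with \<open>a\<close> in \<open>B\<close>
      whenever possible; if \<open>a\<close> lies in \<open>C\<close>, every vertex of
      \<open>B\<close> is adjacent to all others of \<open>C \<union> B\<close>.\<close>
    then obtain a b where ab: "a \<in> C \<union> B" "b \<in> C \<union> B" "a \<noteq> b" "(a, b) \<notin> parcs G"
      and pref: "a \<in> C \<Longrightarrow> \<forall>c \<in> B. \<forall>d \<in> C \<union> B. c \<noteq> d \<longrightarrow> (c, d) \<in> parcs G"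
    proof (cases "\<exists>a \<in> B. \<exists>b \<in> C \<union> B. a \<noteq> b \<and> (a, b) \<notin> parcs G")
      case True
      then obtain a b where "a \<in> B" "b \<in> C \<union> B" "a \<noteq> b" "(a, b) \<notin> parcs G" by blast
      moreover have "a \<notin> C" using \<open>a \<in> B\<close> CA by (auto simp: A_def B_def)
      ultimately show thesis using that[of a b] by blast
    next
      case False
      with True that show thesis by blast
    qed
    \<comment> \<open>The inclusion is strict because \<open>v\<close> is left out; the induction
      hypothesis is applied with \<open>a\<close> in the role of \<open>v\<close>.\<close>
    have "C \<union> B \<subset> T"
      using CA psubset.prems arcs_irrefl by (auto simp: A_def B_def)
    from psubset.IH[OF this ab(1,2)] ab(3,4) obtain s where s: "s \<in> C \<union> B" "s \<noteq> a"
      "(a, s) \<notin> parcs G" "simplicial (parcs G) (C \<union> B) s" by blast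
    \<comment> \<open>A vertex of \<open>B\<close> other than \<open>a\<close> is adjacent to
      \<open>a\<close>: if \<open>a\<close> is in \<open>B\<close>, because \<open>B\<close> is a
      clique; otherwise by the choice of \<open>a\<close>.\<close>
    have "s \<notin> B"
      using s ab(1) pref clique_B arcs_sym by (metis Un_iff)
    with s show ?thesis by blast
  qed
  then obtain s where s: "s \<in> C" "simplicial (parcs G) (C \<union> B) s" by blast
  then have "simplicial (parcs G) T s"
    using nbr_C by (auto simp: simplicial_def)
  with s CA show ?case by (auto simp: A_def)
qed

lemma ex_simplicial:
  assumes "chordal G" "finite T" "T \<noteq> {}"
  shows "\<exists>s \<in> T. simplicial (parcs G) T s"
proof (cases "\<exists>u \<in> T. \<exists>v \<in> T. u \<noteq> v \<and> (v, u) \<notin> parcs G")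
  case True
  then show ?thesis using ex_simplicial_nonneighbour[OF assms(1,2)] by metis
next
  case False
  then have "simplicial (parcs G) T s" for s unfolding simplicial_def by metis
  with assms(3) show ?thesis by blast
qed

text \<open>Simplicial vertices are removed one after another; each is ranked below all vertices
  still present.\<close>

lemma ex_perfect_elimination_ranking:
  assumes "chordal G" "finite T"
  shows "\<exists>r :: 'a \<Rightarrow> nat. inj_on r T \<and> (\<forall>v \<in> T. simplicial (parcs G) {x \<in> T. r v \<le> r x} v)"
  using assms(2)
proof (induction T rule: finite_psubset_induct)
  case (psubset T)
  show ?case
  proof (cases "T = {}")
    case False
    then obtain s where s: "s \<in> T" "simplicial (parcs G) T s"
      using ex_simplicial[OF assms(1) psubset.hyps] by blast
    then obtain r :: "'a \<Rightarrow> nat" where r: "inj_on r (T - {s})"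
      "\<And>v. v \<in> T - {s} \<Longrightarrow> simplicial (parcs G) {x \<in> T - {s}. r v \<le> r x} v"
      using psubset.IH[of "T - {s}"] by blast
    \<comment> \<open>Shifting the old ranks by one frees rank 0 for \<open>s\<close>, so
      \<open>s\<close> comes first and drops out of the later sets.\<close>
    define r' where "r' x = (if x = s then 0 else Suc (r x))" for x
    have "inj_on r' T" using r(1) by (auto simp: inj_on_def r'_def)
    moreover have "simplicial (parcs G) {x \<in> T. r' v \<le> r' x} v" if "v \<in> T" for v
    proof (cases "v = s")
      case True
      then show ?thesis using s by (auto simp: simplicial_def)
    next
      case False
      then have "{x \<in> T. r' v \<le> r' x} = {x \<in> T - {s}. r v \<le> r x}" by (auto simp: r'_def)
      then show ?thesis using r(2) False that by simp
    qed
    ultimately show ?thesis by blast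
  qed simp
qed

section \<open>Covers by maximal cliques and their realization by acyclic digraphs\<close>

lemma ex_minimum_cover_of_maximal_cliques:
  "\<exists>\<C>. minimum_edge_clique_cover G \<C> \<and> (\<forall>K \<in> \<C>. maximal_clique G K)"
proof -
  \<comment> \<open>The edges themselves, as two-element cliques, form a cover, so the minimum in
    \<open>edge_clique_cover_number\<close> is attained.\<close>
  have "edge_clique_cover G {{x, y} | x y. (x, y) \<in> parcs G}"
  proof -
    have "{{x, y} | x y. (x, y) \<in> parcs G} = (\<lambda>(x, y). {x, y}) ` parcs G" by auto
    then have "finite {{x, y} | x y. (x, y) \<in> parcs G}" using pair_finite_arcs by simp
    then show ?thesis
      by (auto simp: edge_clique_cover_def clique_def arcs_sym dest: in_arcsD1 in_arcsD2)
  qed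
  then have "\<exists>n. \<exists>\<C>. edge_clique_cover G \<C> \<and> card \<C> = n" by blast
  from LeastI_ex[OF this] obtain \<C> where \<C>: "edge_clique_cover G \<C>"
    "card \<C> = edge_clique_cover_number G"
    unfolding edge_clique_cover_number_def by blast
  have "\<forall>K \<in> \<C>. \<exists>M. maximal_clique G M \<and> K \<subseteq> M"
    using \<C>(1) maximal_clique_extends[OF pair_finite_verts] by (metis edge_clique_cover_def)
  then obtain m where m: "\<And>K. K \<in> \<C> \<Longrightarrow> maximal_clique G (m K)" "\<And>K. K \<in> \<C> \<Longrightarrow> K \<subseteq> m K"
    by metis
  \<comment> \<open>Enlarging the cliques of a minimum cover to maximal ones keeps all edges covered
    and cannot increase their number.\<close>
  have cover: "edge_clique_cover G (m ` \<C>)"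
    unfolding edge_clique_cover_def
  proof (intro conjI allI impI)
    show "\<forall>K \<in> m ` \<C>. clique G K" using m(1) by (auto simp: maximal_clique_def)
    show "\<exists>K \<in> m ` \<C>. x \<in> K \<and> y \<in> K" if "(x, y) \<in> parcs G" for x y
      using that \<C>(1) m(2) unfolding edge_clique_cover_def by blast
  qed (use \<C>(1) in \<open>simp add: edge_clique_cover_def\<close>)
  moreover have "card (m ` \<C>) \<le> card \<C>"
    using \<C>(1) by (auto simp: edge_clique_cover_def intro: card_image_le)
  ultimately show ?thesis
    using \<C>(2) m(1) clique_cover_number_le[OF cover]
    by (intro exI[of _ "m ` \<C>"]) (auto simp: minimum_edge_clique_cover_def)
qed

text \<open>The vertex \<open>z\<close> receives the arcs from the first clique. With
  \<open>k\<close> arbitrary, the result both bounds the competition number and realizes the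
  cover.\<close>

lemma chordal_cover_realization:
  assumes "chordal G" and cover: "edge_clique_cover G \<C>"
    and maximal: "\<And>K. K \<in> \<C> \<Longrightarrow> maximal_clique G K"
    and edge: "\<And>K. K \<in> \<C> \<Longrightarrow> \<exists>x \<in> K. \<exists>y \<in> K. (x, y) \<in> parcs G"
    and z: "z \<in> pverts (add_isolated G k)" "\<And>x y. z = Inl x \<Longrightarrow> (x, y) \<notin> parcs G"
  shows "\<exists>D w. pair_digraph D \<and> acyclic (parcs D) \<and>
      competition_graph D = add_isolated G k \<and>
      bij_betw w \<C> {v \<in> pverts D. in_degree (with_proj D) v \<noteq> 0} \<and>
      (\<forall>K \<in> \<C>. \<forall>x \<in> K. (Inl x, w K) \<in> parcs D)"
proof -
  obtain r :: "'a \<Rightarrow> nat" where r: "inj_on r (pverts G)"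
    "\<And>v. v \<in> pverts G \<Longrightarrow> simplicial (parcs G) {x \<in> pverts G. r v \<le> r x} v"
    using ex_perfect_elimination_ranking[OF assms(1) pair_finite_verts] by blast
  have clq: "K \<subseteq> pverts G" "\<And>x y. x \<in> K \<Longrightarrow> y \<in> K \<Longrightarrow> x \<noteq> y \<Longrightarrow> (x, y) \<in> parcs G"
    if "K \<in> \<C>" for K
    using maximal[OF that] by (auto simp: maximal_clique_def clique_def)
  have nbr: "\<exists>y. (x, y) \<in> parcs G" if "K \<in> \<C>" "x \<in> K" for K x
    using edge[OF that(1)] clq(2)[OF that(1)] that(2) by metis
  have fin\<C>: "finite \<C>" using cover by (simp add: edge_clique_cover_def)
  have "\<exists>x \<in> K. \<forall>y \<in> K. r x \<le> r y" if "K \<in> \<C>" for K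
  proof -
    have "\<exists>x. x \<in> K" using edge[OF that] by blast
    then show ?thesis using ex_has_least_nat[of "\<lambda>x. x \<in> K" _ r] by blast
  qed
  then obtain f where f: "\<And>K. K \<in> \<C> \<Longrightarrow> f K \<in> K"
    "\<And>K x. K \<in> \<C> \<Longrightarrow> x \<in> K \<Longrightarrow> r (f K) \<le> r x"
    by metis
  have fV: "f K \<in> pverts G" if "K \<in> \<C>" for K using f(1) clq(1) that by blast
  \<comment> \<open>Outside the common first vertex, \<open>K\<close> and \<open>L\<close> consist
    of later neighbours of it. These form a clique, so \<open>K \<union> L\<close> is a clique and
    maximality gives \<open>K = L\<close>.\<close>
  have inj_f: "K = L" if KL: "K \<in> \<C>" "L \<in> \<C>" "f K = f L" for K L
  proof -
    have "(x, y) \<in> parcs G" if xy: "x \<in> K" "y \<in> L" "x \<noteq> y" for x y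
    proof (cases "x = f K \<or> y = f K")
      case True
      then show ?thesis using clq(2) f(1) KL xy by metis
    next
      case False
      then have "(f K, x) \<in> parcs G" "(f K, y) \<in> parcs G"
        using clq(2) f(1) KL xy by metis+
      moreover have "x \<in> {x \<in> pverts G. r (f K) \<le> r x}" "y \<in> {x \<in> pverts G. r (f K) \<le> r x}"
        using xy KL clq(1) f(2)[of K x] f(2)[of L y] by auto
      ultimately show ?thesis
        using r(2)[OF fV[OF KL(1)]] xy(3) unfolding simplicial_def by blast
    qed
    then have "clique G (K \<union> L)"
      using clq KL arcs_sym unfolding clique_def by (metis Un_iff Un_subset_iff)
    then show ?thesis
      using maximal[OF KL(1)] maximal[OF KL(2)] unfolding maximal_clique_def by blast
  qed
  obtain p where p: "\<And>K. K \<in> \<C> \<Longrightarrow>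
    p K = None \<and> (\<forall>L \<in> \<C>. r (f K) \<le> r (f L)) \<or>
    (\<exists>L \<in> \<C>. p K = Some L \<and> r (f L) < r (f K) \<and>
      (\<forall>M \<in> \<C>. r (f M) < r (f K) \<longrightarrow> r (f M) \<le> r (f L)))"
    using ex_predecessor_map[OF fin\<C>, of "\<lambda>K. r (f K)"] by blast
  define w where "w K = (case p K of None \<Rightarrow> z | Some L \<Rightarrow> Inl (f L))" for K
  define D where "D = \<lparr> pverts = pverts (add_isolated G k),
    parcs = {(Inl x, w K) | x K. K \<in> \<C> \<and> x \<in> K} \<rparr>"
  \<comment> \<open>A height that drops along every arc of \<open>D\<close>. It is 0 at
    \<open>z\<close>, even if \<open>z\<close> is a vertex of \<open>G\<close>; the successor keeps
    every vertex of a clique above \<open>z\<close>.\<close>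
  define h where "h v = (if v = z then 0 else case v of Inl x \<Rightarrow> Suc (r x) | Inr _ \<Rightarrow> 0)" for v
  have fz: "Inl x \<noteq> z" if "K \<in> \<C>" "x \<in> K" for K x
    using nbr[OF that] z(2) by metis
  have rank_f: "r (f K) = r (f L) \<Longrightarrow> K = L" if "K \<in> \<C>" "L \<in> \<C>" for K L
    using inj_f r(1) fV that by (metis inj_onD)
  \<comment> \<open>The predecessor of \<open>L\<close> ranks no lower than \<open>K\<close>, while
    \<open>w K\<close> is \<open>z\<close> or a first vertex ranked strictly below that of
    \<open>K\<close>.\<close>
  have w_less: "w K \<noteq> w L" if KL: "K \<in> \<C>" "L \<in> \<C>" "r (f K) < r (f L)" for K L
  proof -
    obtain M where M: "M \<in> \<C>" "p L = Some M" "r (f K) \<le> r (f M)"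
      using p[OF KL(2)] KL by (meson not_le)
    have "w L = Inl (f M)" using M by (simp add: w_def)
    moreover have "w K = z \<or> (\<exists>N \<in> \<C>. w K = Inl (f N) \<and> r (f N) < r (f K))"
      using p[OF KL(1)] by (auto simp: w_def)
    ultimately show ?thesis using M fz[OF M(1) f(1)[OF M(1)]] by fastforce
  qed
  have inj_w: "inj_on w \<C>"
  proof (rule inj_onI)
    fix K L assume KL: "K \<in> \<C>" "L \<in> \<C>" "w K = w L"
    then have "r (f K) = r (f L)"
      using w_less[of K L] w_less[of L K] by (cases rule: linorder_cases) auto
    with KL rank_f show "K = L" by blast
  qed
  have wV: "w K \<in> pverts D" if "K \<in> \<C>" for K
    using p[OF that] z(1) fV by (auto simp: w_def D_def add_isolated_def)
  have arcV: "Inl x \<in> pverts D" if "K \<in> \<C>" "x \<in> K" for K x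
    using clq(1) that by (auto simp: D_def add_isolated_def)
  have finV: "finite (pverts D)"
    using pair_finite_verts by (simp add: D_def add_isolated_def)
  have arc_iff: "(a, b) \<in> parcs D \<longleftrightarrow> (\<exists>x K. a = Inl x \<and> b = w K \<and> K \<in> \<C> \<and> x \<in> K)" for a b
    by (auto simp: D_def)
  \<comment> \<open>The source has height at least \<open>Suc (r (f K))\<close>, and the target at
    most \<open>r (f K)\<close>, being \<open>z\<close> or a first vertex of smaller rank.\<close>
  have descend: "h b < h a" if ab: "(a, b) \<in> parcs D" for a b
  proof -
    obtain x K where xK: "a = Inl x" "b = w K" "K \<in> \<C>" "x \<in> K" using ab arc_iff by blast
    then have "h a = Suc (r x)" using fz by (auto simp: h_def)
    moreover have "h b \<le> r (f K)"
      using p[OF xK(3)] xK(2) by (auto simp: w_def h_def)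
    ultimately show ?thesis using f(2) xK by fastforce
  qed
  have finE: "finite (parcs D)"
    by (rule finite_subset[of _ "pverts D \<times> pverts D"]) (use arc_iff arcV wV finV in auto)
  have dig: "pair_digraph D"
    using arc_iff arcV wV finV finE descend by unfold_locales fastforce+
  have acy: "acyclic (parcs D)"
    by (rule acyclicI_order[of _ h]) (rule descend)
  have "parcs (competition_graph D) = parcs (add_isolated G k)"
  proof (intro set_eqI iffI; clarify)
    fix a b assume "(a, b) \<in> parcs (competition_graph D)"
    then obtain c where "a \<noteq> b" "(a, c) \<in> parcs D" "(b, c) \<in> parcs D"
      by (auto simp: competition_graph_def)
    \<comment> \<open>Injectivity of \<open>w\<close> turns the common out-neighbour into a common
      clique.\<close>
    then obtain x y K where "a = Inl x" "b = Inl y" "K \<in> \<C>" "x \<in> K" "y \<in> K" "x \<noteq> y"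
      unfolding arc_iff using inj_w by (metis inj_onD)
    then show "(a, b) \<in> parcs (add_isolated G k)"
      using clq(2) by (auto simp: add_isolated_def)
  next
    fix a b assume "(a, b) \<in> parcs (add_isolated G k)"
    then obtain x y where xy: "a = Inl x" "b = Inl y" "(x, y) \<in> parcs G"
      by (auto simp: add_isolated_def)
    then obtain K where K: "K \<in> \<C>" "x \<in> K" "y \<in> K"
      using cover unfolding edge_clique_cover_def by blast
    then have "(a, w K) \<in> parcs D" "(b, w K) \<in> parcs D" "a \<in> pverts D" "b \<in> pverts D"
      "w K \<in> pverts D" "a \<noteq> b"
      using xy arc_iff arcV wV arcs_irrefl by auto
    then show "(a, b) \<in> parcs (competition_graph D)"
      by (auto simp: competition_graph_def)
  qed
  then have comp: "competition_graph D = add_isolated G k"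
    by (simp add: competition_graph_def D_def)
  \<comment> \<open>\<open>in_degree\<close> is a cardinality, so finiteness is needed to read
    nonzero as nonempty.\<close>
  have "in_degree (with_proj D) v \<noteq> 0 \<longleftrightarrow> (\<exists>u. (u, v) \<in> parcs D)" for v
  proof -
    have "finite (in_arcs (with_proj D) v)"
      by (rule finite_subset[OF _ finE]) (auto simp: in_arcs_def)
    then show ?thesis by (auto simp: in_degree_def in_arcs_def)
  qed
  then have "{v \<in> pverts D. in_degree (with_proj D) v \<noteq> 0} = w ` \<C>"
    using arc_iff f(1) wV by (auto; blast)
  with inj_w have "bij_betw w \<C> {v \<in> pverts D. in_degree (with_proj D) v \<noteq> 0}"
    by (simp add: bij_betw_def)
  with dig acy comp arc_iff show ?thesis by blast
qed

end

theorem theorem2p2: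
  fixes G :: "'a pair_pre_digraph"
  assumes "pair_graph G"
    and "chordal G"
    and "parcs G \<noteq> {}"
  shows "\<exists>\<C>. effective_competition_cover G \<C>"
proof -
  interpret pair_graph G by (rule assms(1))
  obtain \<C> where \<C>: "minimum_edge_clique_cover G \<C>" "\<And>K. K \<in> \<C> \<Longrightarrow> maximal_clique G K"
    using ex_minimum_cover_of_maximal_cliques by blast
  have cover: "edge_clique_cover G \<C>" using \<C>(1) by (simp add: minimum_edge_clique_cover_def)
  note realize = chordal_cover_realization[OF assms(2) cover \<C>(2)
      minimum_cover_has_edge[OF \<C>(1)]]
  let ?ok = "\<lambda>k. \<exists>D. pair_digraph D \<and> acyclic (parcs D) \<and> competition_graph D = add_isolated G k"
  obtain z where "z \<in> pverts (add_isolated G (competition_number G))"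
    "\<And>x y. z = Inl x \<Longrightarrow> (x, y) \<notin> parcs G"
  \<comment> \<open>An isolated vertex of \<open>G\<close> serves as \<open>z\<close> for every
    number of new vertices; otherwise \<open>z\<close> is a new vertex, which requires a positive
    competition number.\<close>
  proof (cases "\<exists>v \<in> pverts G. \<forall>u. (v, u) \<notin> parcs G")
    case True
    then obtain v where "v \<in> pverts G" "\<And>u. (v, u) \<notin> parcs G" by blast
    then show thesis by (intro that[of "Inl v"]) (auto simp: add_isolated_def)
  next
    case False
    \<comment> \<open>One new vertex suffices as \<open>z\<close>, so the minimum defining the
      competition number is attained.\<close>
    have "?ok 1" using realize[of "Inr 0" 1] by (auto simp: add_isolated_def)
    then have "?ok (competition_number G)"
      unfolding competition_number_def by (rule LeastI)
    \<comment> \<open>Without new vertices, a sink of \<open>D\<close> would be an isolated vertex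
      of \<open>G\<close>.\<close>
    moreover have "\<not> ?ok 0"
    proof
      assume "?ok 0"
      then obtain D where D: "pair_digraph D" "acyclic (parcs D)"
        "competition_graph D = add_isolated G 0" by blast
      have "pverts D = Inl ` pverts G"
        using D(3) by (simp add: competition_graph_def add_isolated_def)
      moreover have "pverts G \<noteq> {}" using assms(3) in_arcsD1 by auto
      ultimately show False
        using acyclic_competition_graph_has_isolated[OF D(1,2)] False unfolding D(3)
        by (auto simp: add_isolated_def)
    qed
    ultimately have "0 < competition_number G" by (metis gr0I)
    then show thesis by (intro that[of "Inr 0"]) (auto simp: add_isolated_def)
  qed
  from realize[OF _ _ this] \<C> show ?thesis
    unfolding effective_competition_cover_def by blast
qed

end
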